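(* Let $\mathbb{F}$ be a field of characteristic $0$, let $A\neq 0$ be an abelian group, and let $\partial: A\to\mathbb{F}$ be an additive map with $\partial(x)\neq 0$ for all $x\neq 0$. Then the generalized Heisenberg-Virasoro algebra $\mathcal{L}$ associated with $(A,\partial)$ is the universal central extension of the Lie algebra $\mathcal{D}_1$ of generalized differential operators of order at most one, via the projection $\mathcal{L}\to\mathcal{D}_1$ given by $L(x)\mapsto t^x\partial$, $I(x)\mapsto t^x$ ($x\in A$), and $C_L, C_I, C_{LI}\mapsto 0$.
   Context: Setting: $\mathbb{F}$ is a field of characteristic $0$, $A\ne 0$ is an abelian group, $T=\mathbb{F}\partial$ is a one-dimensional vector space, and $\varphi:T\times A\to\mathbb{F}$ is a pairing, $\mathbb{F}$-linear in the first variable and additive in the second; write $\partial(x)=\varphi(\partial,x)$, so $\partial: A\to \mathbb{F}$ is additive. The pairing is nondegenerate, i.e. $\partial(x)=0$ implies $x=0$. The Lie algebra $\mathcal{D}_1$ is the $\mathbb{F}$-vector space with basis $\{t^x\partial,\ t^x \mid x\in A\}$ and brackets, for $x,y\in A$, $$[t^x\partial,t^y\partial]=\partial(y-x)\,t^{x+y}\partial,\qquad [t^x\partial,t^y]=\partial(y)\,t^{x+y},\qquad [t^x,t^y]=0.$$ The generalized Heisenberg-Virasoro algebra $\mathcal{L}$ is the Lie algebra over $\mathbb{F}$ with basis $\{L(x), I(x), C_L, C_I, C_{LI}\mid x\in A\}$ and brackets, for $x,y\in A$, $$[L(x),L(y)]=\partial(y-x)L(x+y)+\delta_{x+y,0}\tfrac{1}{12}(\partial(x)^3-\partial(x))C_L,$$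 $$[I(x),I(y)]=\partial(y)\delta_{x+y,0}C_I,$$ $$[L(x),I(y)]=\partial(y)I(x+y)+\delta_{x+y,0}(\partial(x)^2-\partial(x))C_{LI},$$ $$[\mathcal{L},C_L]=[\mathcal{L},C_I]=[\mathcal{L},C_{LI}]=0.$$ *)

theory Defs
  imports Complex_Main "HOL-Library.Poly_Mapping"
begin

section \<open>Lie algebras and central extensions\<close>

locale lie_algebra = vector_space scale
  for scale :: "'f::field \<Rightarrow> 'g::ab_group_add \<Rightarrow> 'g" +
  fixes bracket :: "'g \<Rightarrow> 'g \<Rightarrow> 'g"
  assumes linear_right: "Vector_Spaces.linear scale scale (\<lambda>y. bracket x y)"
    and linear_left: "Vector_Spaces.linear scale scale (\<lambda>x. bracket x y)"
    and alternating: "bracket x x = 0"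
    and jacobi: "bracket x (bracket y z) + bracket y (bracket z x) + bracket z (bracket x y) = 0"

locale lie_algebra_hom =
  dom: lie_algebra sG bG + cod: lie_algebra sH bH + Vector_Spaces.linear sG sH h
  for sG :: "'f::field \<Rightarrow> 'g::ab_group_add \<Rightarrow> 'g" and bG :: "'g \<Rightarrow> 'g \<Rightarrow> 'g"
    and sH :: "'f \<Rightarrow> 'h::ab_group_add \<Rightarrow> 'h" and bH :: "'h \<Rightarrow> 'h \<Rightarrow> 'h"
    and h :: "'g \<Rightarrow> 'h" +
  assumes hom_bracket: "h (bG x y) = bH (h x) (h y)"

locale central_extension = lie_algebra_hom sE bE sG bG p
  for sE :: "'f::field \<Rightarrow> 'e::ab_group_add \<Rightarrow> 'e" and bE :: "'e \<Rightarrow> 'e \<Rightarrow> 'e"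
    and sG :: "'f \<Rightarrow> 'g::ab_group_add \<Rightarrow> 'g" and bG :: "'g \<Rightarrow> 'g \<Rightarrow> 'g"
    and p :: "'e \<Rightarrow> 'g" +
  assumes surj_proj: "surj p"
    and kernel_central: "p z = 0 \<Longrightarrow> bE z x = 0"

text \<open>
  HOL cannot quantify over types inside a definition, so the type of the competing central
  extensions is the parameter \<^typ>\<open>'e itself\<close>. Universality among all central extensions is
  expressed by leaving \<open>'e\<close> a free (hence universally quantified) type variable in a theorem.
\<close>

definition universal_central_extension ::
  "'e::ab_group_add itself \<Rightarrow> ('f::field \<Rightarrow> 'u::ab_group_add \<Rightarrow> 'u) \<Rightarrow> ('u \<Rightarrow> 'u \<Rightarrow> 'u) \<Rightarrow>
    ('f \<Rightarrow> 'g::ab_group_add \<Rightarrow> 'g) \<Rightarrow> ('g \<Rightarrow> 'g \<Rightarrow> 'g) \<Rightarrow> ('u \<Rightarrow> 'g) \<Rightarrow> bool" where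
  "universal_central_extension TYPE('e) sU bU sG bG p \<longleftrightarrow>
     central_extension sU bU sG bG p \<and>
     (\<forall>(sE :: 'f \<Rightarrow> 'e \<Rightarrow> 'e) bE q. central_extension sE bE sG bG q \<longrightarrow>
        (\<exists>!h. lie_algebra_hom sU bU sE bE h \<and> q \<circ> h = p))"


section \<open>Free vector spaces\<close>

text \<open>
  The vector space over \<open>'f\<close> with basis \<open>'b\<close> is \<^typ>\<open>'b \<Rightarrow>\<^sub>0 'f\<close>; the basis vector of \<open>b\<close> is
  \<^term>\<open>Poly_Mapping.single b 1\<close>.
\<close>

definition free_scale :: "'f::field \<Rightarrow> ('b \<Rightarrow>\<^sub>0 'f) \<Rightarrow> ('b \<Rightarrow>\<^sub>0 'f)" where
  "free_scale c u = Poly_Mapping.map (\<lambda>a. c * a) u"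

definition linear_ext :: "('b \<Rightarrow> ('c \<Rightarrow>\<^sub>0 'f)) \<Rightarrow> ('b \<Rightarrow>\<^sub>0 'f::field) \<Rightarrow> ('c \<Rightarrow>\<^sub>0 'f)" where
  "linear_ext f u = (\<Sum>b\<in>Poly_Mapping.keys u. free_scale (Poly_Mapping.lookup u b) (f b))"

definition bilinear_ext ::
  "('b \<Rightarrow> 'b \<Rightarrow> ('c \<Rightarrow>\<^sub>0 'f)) \<Rightarrow> ('b \<Rightarrow>\<^sub>0 'f::field) \<Rightarrow> ('b \<Rightarrow>\<^sub>0 'f) \<Rightarrow> ('c \<Rightarrow>\<^sub>0 'f)" where
  "bilinear_ext f u v = linear_ext (\<lambda>b. linear_ext (f b) v) u"

lemma lookup_free_scale [simp]:
  "Poly_Mapping.lookup (free_scale c u) b = c * Poly_Mapping.lookup u b"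
  by (auto simp: free_scale_def Poly_Mapping.map.rep_eq when_def)

lemma vector_space_free_scale: "vector_space free_scale"
  by unfold_locales (auto intro!: poly_mapping_eqI simp: lookup_add algebra_simps)

lemma linear_ext_single [simp]: "linear_ext f (Poly_Mapping.single b 1) = f b"
  by (auto intro!: poly_mapping_eqI simp: linear_ext_def)

lemma bilinear_ext_single [simp]:
  "bilinear_ext f (Poly_Mapping.single b 1) (Poly_Mapping.single c 1) = f b c"
  by (simp add: bilinear_ext_def)


section \<open>Generalized differential operators of order at most one\<close>

text \<open>\<open>TD x\<close> and \<open>T x\<close> index the basis vectors $t^x\partial$ and $t^x$.\<close>

datatype 'a d1_basis = TD 'a | T 'a

fun d1_basis_bracket ::
  "('a::ab_group_add \<Rightarrow> 'f::field) \<Rightarrow> 'a d1_basis \<Rightarrow> 'a d1_basis \<Rightarrow> ('a d1_basis \<Rightarrow>\<^sub>0 'f)" where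
  "d1_basis_bracket d (TD x) (TD y) = Poly_Mapping.single (TD (x + y)) (d (y - x))"
| "d1_basis_bracket d (TD x) (T y) = Poly_Mapping.single (T (x + y)) (d y)"
| "d1_basis_bracket d (T y) (TD x) = - Poly_Mapping.single (T (x + y)) (d y)"
| "d1_basis_bracket d (T x) (T y) = 0"

definition d1_bracket ::
  "('a::ab_group_add \<Rightarrow> 'f::field) \<Rightarrow>
    ('a d1_basis \<Rightarrow>\<^sub>0 'f) \<Rightarrow> ('a d1_basis \<Rightarrow>\<^sub>0 'f) \<Rightarrow> ('a d1_basis \<Rightarrow>\<^sub>0 'f)" where
  "d1_bracket d = bilinear_ext (d1_basis_bracket d)"


section \<open>The generalized Heisenberg-Virasoro algebra\<close>

datatype 'a hv_basis = L 'a | I 'a | C_L | C_I | C_LI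

fun hv_basis_bracket ::
  "('a::ab_group_add \<Rightarrow> 'f::field) \<Rightarrow> 'a hv_basis \<Rightarrow> 'a hv_basis \<Rightarrow> ('a hv_basis \<Rightarrow>\<^sub>0 'f)" where
  "hv_basis_bracket d (L x) (L y) =
     Poly_Mapping.single (L (x + y)) (d (y - x)) +
     Poly_Mapping.single C_L (if x + y = 0 then 1 / 12 * (d x ^ 3 - d x) else 0)"
| "hv_basis_bracket d (I x) (I y) =
     Poly_Mapping.single C_I (if x + y = 0 then d y else 0)"
| "hv_basis_bracket d (L x) (I y) =
     Poly_Mapping.single (I (x + y)) (d y) +
     Poly_Mapping.single C_LI (if x + y = 0 then d x ^ 2 - d x else 0)"
| "hv_basis_bracket d (I y) (L x) =
     - (Poly_Mapping.single (I (x + y)) (d y) +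
        Poly_Mapping.single C_LI (if x + y = 0 then d x ^ 2 - d x else 0))"
| "hv_basis_bracket d _ _ = 0"

definition hv_bracket ::
  "('a::ab_group_add \<Rightarrow> 'f::field) \<Rightarrow>
    ('a hv_basis \<Rightarrow>\<^sub>0 'f) \<Rightarrow> ('a hv_basis \<Rightarrow>\<^sub>0 'f) \<Rightarrow> ('a hv_basis \<Rightarrow>\<^sub>0 'f)" where
  "hv_bracket d = bilinear_ext (hv_basis_bracket d)"

fun hv_basis_proj :: "'a hv_basis \<Rightarrow> ('a d1_basis \<Rightarrow>\<^sub>0 'f::field)" where
  "hv_basis_proj (L x) = Poly_Mapping.single (TD x) 1"
| "hv_basis_proj (I x) = Poly_Mapping.single (T x) 1"
| "hv_basis_proj C_L = 0"
| "hv_basis_proj C_I = 0"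
| "hv_basis_proj C_LI = 0"

definition hv_proj :: "('a hv_basis \<Rightarrow>\<^sub>0 'f::field) \<Rightarrow> ('a d1_basis \<Rightarrow>\<^sub>0 'f)" where
  "hv_proj = linear_ext hv_basis_proj"

end

theory Submission
  imports Defs
begin

text \<open>
  Given a central extension \<open>q : E \<rightarrow> D\<^sub>1\<close>, a linear lift \<open>h\<close> of the projection has a defect
  \<open>(u, v) \<mapsto> [h u, h v] - h [u, v]\<close>, which is a 2-cocycle with central values. Choosing \<open>h (L x)\<close>
  and \<open>h (I x)\<close>, for nonzero \<open>x\<close>, as eigenvectors of a lift of \<open>t\<^sup>0\<partial>\<close> makes the defect invariant
  under \<open>L 0\<close>, so it vanishes on pairs of basis vectors whose weights do not add up to \<open>0\<close>. On the
  pairs of weight \<open>(x, -x)\<close> the cocycle identity becomes a functional equation in \<open>x\<close>; a solution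
  that is \<open>0\<close> at one \<open>y \<noteq> 0\<close> and at \<open>2y\<close> is \<open>0\<close> everywhere, and the images of \<open>L 0\<close>,
  \<open>I 0\<close> and the central elements are chosen so that the defect is \<open>0\<close> there. Uniqueness holds because
  the generalized Heisenberg-Virasoro algebra is spanned by brackets.
\<close>

section \<open>Linear and bilinear maps on free vector spaces\<close>

abbreviation basis_vec :: "'b \<Rightarrow> ('b \<Rightarrow>\<^sub>0 'f::field)" where
  "basis_vec b \<equiv> Poly_Mapping.single b 1"

lemma free_scale_single [simp]:
  "free_scale c (Poly_Mapping.single b k) = Poly_Mapping.single b (c * k)"
  by (rule poly_mapping_eqI) (simp add: lookup_single when_def)

interpretation free: vector_space free_scale
  by (rule vector_space_free_scale)

lemma basis_expansion:
  "(\<Sum>b\<in>Poly_Mapping.keys u. free_scale (Poly_Mapping.lookup u b) (basis_vec b)) = u"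
  by (rule poly_mapping_eqI)
    (simp add: lookup_sum lookup_single when_def in_keys_iff sum.delta' cong: if_cong)

lemma linear_free_expansion:
  assumes "Vector_Spaces.linear free_scale s f"
  shows "f u = (\<Sum>b\<in>Poly_Mapping.keys u. s (Poly_Mapping.lookup u b) (f (basis_vec b)))"
proof -
  interpret Vector_Spaces.linear free_scale s f by fact
  have "f u = f (\<Sum>b\<in>Poly_Mapping.keys u. free_scale (Poly_Mapping.lookup u b) (basis_vec b))"
    by (simp only: basis_expansion)
  then show ?thesis by (simp only: sum scale)
qed

lemma linear_free_eqI:
  assumes "Vector_Spaces.linear free_scale s f" "Vector_Spaces.linear free_scale s g"
    and "\<And>b. f (basis_vec b) = g (basis_vec b)"
  shows "f u = g u"
  using linear_free_expansion[OF assms(1), of u] linear_free_expansion[OF assms(2), of u]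
  by (simp add: assms(3))

text \<open>The formula of \<open>linear_ext\<close> with values in an arbitrary vector space: the
  target of a lift is a competing extension, which need not be a free space.\<close>

definition free_ext ::
  "('f::field \<Rightarrow> 'e \<Rightarrow> 'e) \<Rightarrow> ('b \<Rightarrow> 'e) \<Rightarrow> ('b \<Rightarrow>\<^sub>0 'f) \<Rightarrow> 'e::ab_group_add" where
  "free_ext s g u = (\<Sum>b\<in>Poly_Mapping.keys u. s (Poly_Mapping.lookup u b) (g b))"

lemma linear_free_ext:
  assumes "vector_space s"
  shows "Vector_Spaces.linear free_scale s (free_ext s g)"
proof -
  interpret vector_space s by fact
  \<comment> \<open>Coefficients outside the keys are 0, so \<open>u\<close>, \<open>v\<close> and
    \<open>u + v\<close>, whose keys differ, can be summed over one common finite index set.\<close>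
  have superset: "free_ext s g u = (\<Sum>b\<in>S. s (Poly_Mapping.lookup u b) (g b))"
    if "finite S" "Poly_Mapping.keys u \<subseteq> S" for u S
    unfolding free_ext_def using that
    by (intro sum.mono_neutral_left) (auto simp: in_keys_iff)
  have add: "free_ext s g (u + v) = free_ext s g u + free_ext s g v" for u v
  proof -
    let ?S = "Poly_Mapping.keys u \<union> Poly_Mapping.keys v"
    have "free_ext s g (u + v) = (\<Sum>b\<in>?S. s (Poly_Mapping.lookup (u + v) b) (g b))"
      by (rule superset) (simp_all add: Poly_Mapping.keys_add)
    moreover have "free_ext s g u = (\<Sum>b\<in>?S. s (Poly_Mapping.lookup u b) (g b))"
      by (rule superset) simp_all
    moreover have "free_ext s g v = (\<Sum>b\<in>?S. s (Poly_Mapping.lookup v b) (g b))"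
      by (rule superset) simp_all
    ultimately show ?thesis
      by (simp only: lookup_add scale_left_distrib sum.distrib)
  qed
  have scale: "free_ext s g (free_scale c u) = s c (free_ext s g u)" for c u
  proof -
    have "free_ext s g (free_scale c u)
        = (\<Sum>b\<in>Poly_Mapping.keys u. s (Poly_Mapping.lookup (free_scale c u) b) (g b))"
      by (rule superset) (auto simp: in_keys_iff)
    then show ?thesis
      by (simp only: lookup_free_scale free_ext_def scale_sum_right scale_scale)
  qed
  show ?thesis
    by (simp add: Vector_Spaces.linear_iff vector_space_free_scale assms add scale)
qed

lemma free_ext_basis_vec [simp]:
  assumes "vector_space s"
  shows "free_ext s g (basis_vec b) = g b"
proof -
  interpret vector_space s by fact
  show ?thesis by (simp add: free_ext_def)
qed

lemma linear_linear_ext: "Vector_Spaces.linear free_scale free_scale (linear_ext f)"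
proof -
  have "linear_ext f = free_ext free_scale f"
    by (simp add: fun_eq_iff linear_ext_def free_ext_def)
  then show ?thesis by (simp add: linear_free_ext vector_space_free_scale)
qed

definition bilinear_map ::
  "('f::field \<Rightarrow> 'u::ab_group_add \<Rightarrow> 'u) \<Rightarrow> ('f \<Rightarrow> 'e::ab_group_add \<Rightarrow> 'e) \<Rightarrow> ('u \<Rightarrow> 'u \<Rightarrow> 'e) \<Rightarrow> bool"
  where "bilinear_map s s' B \<longleftrightarrow>
    (\<forall>u. Vector_Spaces.linear s s' (B u)) \<and> (\<forall>v. Vector_Spaces.linear s s' (\<lambda>u. B u v))"

text \<open>For fixed \<open>u\<close> this is a finite sum of scalar multiples of linear maps in
  the second argument; in the first argument it is itself a \<open>linear_ext\<close>.\<close>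

lemma bilinear_bilinear_ext: "bilinear_map free_scale free_scale (bilinear_ext f)"
proof -
  interpret vector_space_pair free_scale free_scale
    by (simp add: vector_space_pair_def vector_space_free_scale)
  have "Vector_Spaces.linear free_scale free_scale (bilinear_ext f u)" for u
    unfolding bilinear_ext_def linear_ext_def[where u = u]
    by (intro linear_compose_sum ballI linear_compose_scale_right linear_linear_ext)
  moreover have "Vector_Spaces.linear free_scale free_scale (\<lambda>u. bilinear_ext f u v)" for v
    unfolding bilinear_ext_def by (rule linear_linear_ext)
  ultimately show ?thesis by (simp add: bilinear_map_def)
qed

lemma bilinear_free_eqI:
  assumes "bilinear_map free_scale s B" "bilinear_map free_scale s B'"
    and "\<And>b c. B (basis_vec b) (basis_vec c) = B' (basis_vec b) (basis_vec c)"
  shows "B u v = B' u v"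
proof (rule linear_free_eqI[where s = s and f = "B u" and g = "B' u"])
  fix c
  show "B u (basis_vec c) = B' u (basis_vec c)"
    by (rule linear_free_eqI[where s = s and f = "\<lambda>u. B u (basis_vec c)"
          and g = "\<lambda>u. B' u (basis_vec c)"])
      (use assms in \<open>simp_all add: bilinear_map_def\<close>)
qed (use assms in \<open>simp_all add: bilinear_map_def\<close>)

lemma bilinear_mapI:
  assumes "vector_space s" "vector_space s'"
    and "\<And>u v w. B (u + v) w = B u w + B v w" "\<And>c u w. B (s c u) w = s' c (B u w)"
    and "\<And>u v w. B u (v + w) = B u v + B u w" "\<And>c u w. B u (s c w) = s' c (B u w)"
  shows "bilinear_map s s' B"
  using assms by (simp add: bilinear_map_def Vector_Spaces.linear_iff)

lemma bilinear_map_simps: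
  assumes "bilinear_map s s' B"
  shows "B (u + v) w = B u w + B v w" "B (s c u) w = s' c (B u w)"
    "B u (v + w) = B u v + B u w" "B u (s c w) = s' c (B u w)"
    "B 0 w = 0" "B w 0 = 0" "B (- u) w = - B u w" "B u (- w) = - B u w"
    "B (u - v) w = B u w - B v w" "B u (v - w) = B u v - B u w"
proof -
  interpret l: Vector_Spaces.linear s s' "\<lambda>u. B u w" for w
    using assms by (simp add: bilinear_map_def)
  interpret r: Vector_Spaces.linear s s' "B u" for u
    using assms by (simp add: bilinear_map_def)
  show "B (u + v) w = B u w + B v w" "B (s c u) w = s' c (B u w)"
    "B u (v + w) = B u v + B u w" "B u (s c w) = s' c (B u w)"
    "B 0 w = 0" "B w 0 = 0" "B (- u) w = - B u w" "B u (- w) = - B u w"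
    "B (u - v) w = B u w - B v w" "B u (v - w) = B u v - B u w"
    by (simp_all only: l.add l.scale r.add r.scale l.zero r.zero l.neg r.neg l.diff r.diff)
qed

lemma bilinear_ext_singles:
  "bilinear_ext f (Poly_Mapping.single b k) (Poly_Mapping.single c l) = free_scale (k * l) (f b c)"
proof -
  have "bilinear_ext f (free_scale k (basis_vec b)) (free_scale l (basis_vec c))
      = free_scale (k * l) (f b c)"
    by (simp only: bilinear_map_simps[OF bilinear_bilinear_ext] bilinear_ext_single free.scale_scale mult.commute)
  then show ?thesis by simp
qed

lemma linear_simps:
  assumes "Vector_Spaces.linear s s' f"
  shows "f (u + v) = f u + f v" "f (s c u) = s' c (f u)" "f 0 = 0" "f (- u) = - f u"
    "f (u - v) = f u - f v"
proof -
  interpret Vector_Spaces.linear s s' f by fact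
  show "f (u + v) = f u + f v" "f (s c u) = s' c (f u)" "f 0 = 0" "f (- u) = - f u"
    "f (u - v) = f u - f v"
    by (simp_all only: add scale zero neg diff)
qed

section \<open>The Lie algebra structures\<close>

lemma eq_uminus_self_imp_zero:
  fixes a :: "'f::field_char_0"
  assumes "a = - a"
  shows "a = 0"
proof -
  have "2 * a = a + a" by simp
  also have "\<dots> = 0" using assms by (metis add.right_inverse)
  finally show ?thesis by simp
qed

text \<open>Antisymmetry is a bilinear identity and Jacobi a trilinear one, so both can be checked
  on basis vectors. Alternation is deduced from antisymmetry, which is where characteristic 0
  enters.\<close>

lemma lie_algebra_free:
  fixes f :: "'b \<Rightarrow> 'b \<Rightarrow> ('b \<Rightarrow>\<^sub>0 'f::field_char_0)"
  assumes anti: "\<And>b c. f b c = - f c b"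
    and jacobi: "\<And>b c e. bilinear_ext f (basis_vec b) (f c e) + bilinear_ext f (basis_vec c) (f e b)
      + bilinear_ext f (basis_vec e) (f b c) = 0"
  shows "lie_algebra free_scale (bilinear_ext f)"
proof -
  let ?B = "bilinear_ext f"
  note B = bilinear_bilinear_ext[of f] and S = bilinear_map_simps[OF bilinear_bilinear_ext[of f]]
  note vs = vector_space_free_scale
  have anti': "?B u v = - ?B v u" for u v
  proof (rule bilinear_free_eqI[OF B, where B' = "\<lambda>u v. - ?B v u"])
    show "bilinear_map free_scale free_scale (\<lambda>u v. - ?B v u)"
      by (rule bilinear_mapI) (simp_all only: vs S minus_add_distrib free.scale_minus_right)
    show "?B (basis_vec b) (basis_vec c) = - ?B (basis_vec c) (basis_vec b)" for b c
      by (simp only: bilinear_ext_single) (rule anti)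
  qed
  have alt: "?B u u = 0" for u
  proof (rule poly_mapping_eqI)
    fix b
    have "Poly_Mapping.lookup (?B u u) b = Poly_Mapping.lookup (- ?B u u) b"
      by (rule arg_cong[OF anti'])
    also have "\<dots> = - Poly_Mapping.lookup (?B u u) b"
      by (rule lookup_uminus)
    finally show "Poly_Mapping.lookup (?B u u) b = Poly_Mapping.lookup 0 b"
      unfolding lookup_zero by (rule eq_uminus_self_imp_zero)
  qed
  have jac: "?B u (?B v w) + ?B v (?B w u) + ?B w (?B u v) = 0" for u v w
  proof -
    \<comment> \<open>By the cyclic symmetry of the Jacobi sum, linearity has to be proved in the
      first argument only.\<close>
    define J where "J u v w = ?B u (?B v w) + ?B v (?B w u) + ?B w (?B u v)" for u v w
    have J_rot: "J u v w = J v w u" for u v w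
      unfolding J_def by (simp only: add_ac)
    have J_add: "J (u + u') v w = J u v w + J u' v w" for u u' v w
    proof -
      have "J (u + u') v w = (?B u (?B v w) + ?B u' (?B v w)) + (?B v (?B w u) + ?B v (?B w u'))
          + (?B w (?B u v) + ?B w (?B u' v))"
        by (simp only: J_def S)
      then show ?thesis by (simp only: J_def add_ac)
    qed
    have J_scale: "J (free_scale k u) v w = free_scale k (J u v w)" for k u v w
      by (simp only: J_def S free.scale_right_distrib)
    have lin1: "Vector_Spaces.linear free_scale free_scale (\<lambda>u. J u v w)" for v w
      by (simp only: Vector_Spaces.linear_iff vs J_add J_scale simp_thms)
    have lin2: "Vector_Spaces.linear free_scale free_scale (\<lambda>v. J u v w)" for u w
      by (subst J_rot) (rule lin1)
    have lin3: "Vector_Spaces.linear free_scale free_scale (\<lambda>w. J u v w)" for u v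
      by (subst J_rot, subst J_rot) (rule lin1)
    have lin0: "Vector_Spaces.linear free_scale free_scale (\<lambda>_. 0)"
      by (simp add: Vector_Spaces.linear_iff vs)
    have J0: "J (basis_vec b) (basis_vec c) (basis_vec e) = 0" for b c e
      unfolding J_def bilinear_ext_single by (rule jacobi)
    have J1: "J (basis_vec b) (basis_vec c) w = 0" for b c w
      by (rule linear_free_eqI[OF lin3[of "basis_vec b" "basis_vec c"] lin0]) (rule J0)
    have J2: "J (basis_vec b) v w = 0" for b v w
      by (rule linear_free_eqI[OF lin2[of "basis_vec b" w] lin0]) (rule J1)
    have "J u v w = 0"
      by (rule linear_free_eqI[OF lin1[of v w] lin0]) (rule J2)
    then show ?thesis by (simp add: J_def)
  qed
  show ?thesis
  proof (intro lie_algebra.intro lie_algebra_axioms.intro)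
    show "vector_space (free_scale :: 'f \<Rightarrow> ('b \<Rightarrow>\<^sub>0 'f) \<Rightarrow> _)" by (rule vs)
    show "Vector_Spaces.linear free_scale free_scale (\<lambda>v. ?B u v)"
      and "Vector_Spaces.linear free_scale free_scale (\<lambda>u. ?B u v)" for u v
      using B by (simp_all add: bilinear_map_def)
  qed (rule alt jac)+
qed

lemma lie_algebra_hv:
  fixes d :: "'a::ab_group_add \<Rightarrow> 'f::field_char_0"
  assumes "additive d"
  shows "lie_algebra free_scale (hv_bracket d)"
  unfolding hv_bracket_def
proof (rule lie_algebra_free)
  interpret additive d by fact
  show "hv_basis_bracket d b c = - hv_basis_bracket d c b" for b c
  proof (cases b; cases c)
    fix x y assume bc: "b = L x" "c = L y"
    show ?thesis
    \<comment> \<open>The central term occurs only for \<open>y = - x\<close>, where it is odd in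
      \<open>d x\<close>.\<close>
    proof (cases "x + y = 0")
      case True
      then have "y = - x" by (simp add: eq_neg_iff_add_eq_0 add.commute)
      then show ?thesis
        by (simp add: bc diff minus add minus_divide_left flip: single_uminus)
    next
      case False
      then show ?thesis
        by (simp add: bc diff add.commute flip: single_uminus)
    qed
  next
    fix x y assume bc: "b = I x" "c = I y"
    show ?thesis
    proof (cases "x + y = 0")
      case True
      then have "y = - x" by (simp add: eq_neg_iff_add_eq_0 add.commute)
      then show ?thesis
        by (simp add: bc diff minus flip: single_uminus)
    next
      case False
      then show ?thesis
        by (simp add: bc diff add.commute flip: single_uminus)
    qed
  qed simp_all
  fix b c e
  define J where "J b c e = bilinear_ext (hv_basis_bracket d) (basis_vec b) (hv_basis_bracket d c e)
    + bilinear_ext (hv_basis_bracket d) (basis_vec c) (hv_basis_bracket d e b)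
    + bilinear_ext (hv_basis_bracket d) (basis_vec e) (hv_basis_bracket d b c)" for b c e
  have rot: "J b c e = J c e b" for b c e
    by (simp only: J_def add_ac)
  note S = bilinear_map_simps[OF bilinear_bilinear_ext] bilinear_ext_singles
    free.scale_right_distrib
  \<comment> \<open>A central term survives in a double bracket only if the three indices sum to 0.
    In that case one index is eliminated, and the central coefficients cancel as polynomials in
    \<open>d x\<close> and \<open>d y\<close>.\<close>
  have LLL: "J (L x) (L y) (L z) = 0" for x y z
  proof (cases "x + (y + z) = 0")
    case True
    then have z: "z = - (x + y)" by (simp only: add.assoc [symmetric] add_eq_0_iff)
    show ?thesis
      by (simp add: J_def S z add diff minus)
      (simp add: field_simps power3_eq_cube flip: single_add)
  next
    case False
    then show ?thesis
      by (simp add: J_def S add diff ac_simps) (simp add: algebra_simps flip: single_add)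
  qed
  have LLI: "J (L x) (L y) (I z) = 0" for x y z
  proof (cases "x + (y + z) = 0")
    case True
    then have z: "z = - (x + y)" by (simp only: add.assoc [symmetric] add_eq_0_iff)
    show ?thesis
      by (simp add: J_def S z add diff minus)
      (simp add: field_simps power2_eq_square flip: single_add single_diff single_uminus)
  next
    case False
    then show ?thesis
      by (simp add: J_def S add diff ac_simps)
       (simp add: algebra_simps flip: single_add single_diff single_uminus)
  qed
  have LII: "J (L x) (I y) (I z) = 0" for x y z
  proof (cases "x + (y + z) = 0")
    case True
    then have z: "z = - (x + y)" by (simp only: add.assoc [symmetric] add_eq_0_iff)
    show ?thesis
      by (simp add: J_def S z add diff minus)
      (simp add: field_simps power2_eq_square flip: single_add single_diff single_uminus)
  next
    case False
    then show ?thesis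
      by (simp add: J_def S add diff ac_simps)
  qed
  \<comment> \<open>The other orders of a mixed triple are cyclic rotations of those treated
    above.\<close>
  have LIL: "J (L x) (I y) (L z) = 0" and ILL: "J (I x) (L y) (L z) = 0"
    and ILI: "J (I x) (L y) (I z) = 0" and IIL: "J (I x) (I y) (L z) = 0" for x y z
    using LLI[of z x y] LLI[of y z x] LII[of y z x] LII[of z x y]
    by (simp_all only: rot[of "I x" "L y"] rot[of "I x" "I y"] rot[of "L z"])
  have "J b c e = 0"
    by (cases b; cases c; cases e;
        ((simp only: LLL LLI LIL ILL LII ILI IIL; fail) | (simp add: J_def S; fail)))
  then show "bilinear_ext (hv_basis_bracket d) (basis_vec b) (hv_basis_bracket d c e)
    + bilinear_ext (hv_basis_bracket d) (basis_vec c) (hv_basis_bracket d e b)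
    + bilinear_ext (hv_basis_bracket d) (basis_vec e) (hv_basis_bracket d b c) = 0"
    by (simp add: J_def)
qed


section \<open>The projection onto the differential operators as a central extension\<close>

lemma linear_hv_proj: "Vector_Spaces.linear free_scale free_scale hv_proj"
  unfolding hv_proj_def by (rule linear_linear_ext)

text \<open>The two bracket tables have the same non-central part, and the projection kills the
  central terms.\<close>

lemma hv_proj_bracket:
  assumes "additive d"
  shows "hv_proj (hv_bracket d u v) = d1_bracket d (hv_proj u) (hv_proj v)"
proof (rule bilinear_free_eqI[where s = free_scale and B = "\<lambda>u v. hv_proj (hv_bracket d u v)"
      and B' = "\<lambda>u v. d1_bracket d (hv_proj u) (hv_proj v)"])
  note P = linear_simps[OF linear_hv_proj] and B = bilinear_map_simps[OF bilinear_bilinear_ext]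
  show "bilinear_map free_scale free_scale (\<lambda>u v. hv_proj (hv_bracket d u v))"
    unfolding hv_bracket_def
    by (rule bilinear_mapI) (simp_all only: vector_space_free_scale P B)
  show "bilinear_map free_scale free_scale (\<lambda>u v. d1_bracket d (hv_proj u) (hv_proj v))"
    unfolding d1_bracket_def
    by (rule bilinear_mapI) (simp_all only: vector_space_free_scale P B)
  fix b c :: "'a hv_basis"
  have proj_single: "hv_proj (Poly_Mapping.single b k) = free_scale k (hv_basis_proj b)"
    for b :: "'a hv_basis" and k
    using P(2)[of k "basis_vec b"] by (simp add: hv_proj_def)
  show "hv_proj (hv_bracket d (basis_vec b) (basis_vec c))
      = d1_bracket d (hv_proj (basis_vec b)) (hv_proj (basis_vec c))"
    by (cases b; cases c)
      (simp_all add: hv_bracket_def d1_bracket_def proj_single P B bilinear_ext_single add.commute)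
qed

lemma surj_hv_proj: "surj (hv_proj :: ('a hv_basis \<Rightarrow>\<^sub>0 'f::field) \<Rightarrow> _)"
proof (rule surjI)
  fix u :: "'a d1_basis \<Rightarrow>\<^sub>0 'f"
  define g :: "'a d1_basis \<Rightarrow> ('a hv_basis \<Rightarrow>\<^sub>0 'f)"
    where "g b = basis_vec (case b of TD x \<Rightarrow> L x | T x \<Rightarrow> I x)" for b
  have "hv_proj (linear_ext g u) = id u"
  proof (rule linear_free_eqI[where s = free_scale and f = "\<lambda>u. hv_proj (linear_ext g u)"])
    show "Vector_Spaces.linear free_scale free_scale (\<lambda>u. hv_proj (linear_ext g u))"
      using Vector_Spaces.linear_compose[OF linear_linear_ext linear_hv_proj, of g]
      by (simp only: o_def)
    show "Vector_Spaces.linear free_scale free_scale (id :: ('a d1_basis \<Rightarrow>\<^sub>0 'f) \<Rightarrow> _)"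
      by (rule free.linear_id)
    show "hv_proj (linear_ext g (basis_vec b)) = id (basis_vec b)" for b
      by (cases b) (simp_all add: g_def hv_proj_def)
  qed
  then show "hv_proj (linear_ext g u) = u" by simp
qed

text \<open>Alternation and the Jacobi identity pass to a surjective image. This makes
  \<open>d1_bracket\<close> a Lie bracket without checking a second bracket table.\<close>

lemma lie_algebra_surj_image:
  assumes "lie_algebra sU bU" "Vector_Spaces.linear sU sG p" "surj p"
    and "bilinear_map sG sG bG" "\<And>u v. p (bU u v) = bG (p u) (p v)"
  shows "lie_algebra sG bG"
proof -
  interpret U: lie_algebra sU bU by fact
  interpret p: Vector_Spaces.linear sU sG p by fact
  have hom: "bG (p u) (p v) = p (bU u v)" for u v by (rule assms(5)[symmetric])
  show ?thesis
  proof (intro lie_algebra.intro lie_algebra_axioms.intro)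
    show "vector_space sG" by unfold_locales
    show "Vector_Spaces.linear sG sG (\<lambda>y. bG x y)" "Vector_Spaces.linear sG sG (\<lambda>x. bG x y)" for x y
      using assms(4) by (simp_all add: bilinear_map_def)
    fix x y z
    obtain u v w where [simp]: "x = p u" "y = p v" "z = p w"
      using \<open>surj p\<close> by (metis surjD)
    show "bG x x = 0" by (simp add: hom U.alternating)
    show "bG x (bG y z) + bG y (bG z x) + bG z (bG x y) = 0"
      by (simp add: hom U.jacobi flip: p.add)
  qed
qed

text \<open>The coordinates of \<open>z\<close> at \<open>L x\<close> and \<open>I x\<close> can be
  read off its projection, so an element of the kernel is a combination of \<open>C_L\<close>,
  \<open>C_I\<close> and \<open>C_LI\<close>, whose brackets with all basis vectors are 0.\<close>

lemma hv_proj_kernel_central: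
  fixes d :: "'a::ab_group_add \<Rightarrow> 'f::field"
  assumes "hv_proj z = 0"
  shows "hv_bracket d z u = 0"
proof -
  note B = bilinear_map_simps[OF bilinear_bilinear_ext]
  have zero: "hv_bracket d (basis_vec b) u = 0" if "b \<in> {C_L, C_I, C_LI}" for b
  proof -
    have "hv_bracket d (basis_vec b) u = (\<lambda>_. 0) u"
    proof (rule linear_free_eqI[where s = free_scale and f = "hv_bracket d (basis_vec b)" and g = "\<lambda>_. 0"])
      show "Vector_Spaces.linear free_scale free_scale (hv_bracket d (basis_vec b))"
        using bilinear_bilinear_ext[of "hv_basis_bracket d"] by (simp add: hv_bracket_def bilinear_map_def)
      show "Vector_Spaces.linear free_scale free_scale (\<lambda>_. 0)"
        by (simp add: Vector_Spaces.linear_iff vector_space_free_scale)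
      show "hv_bracket d (basis_vec b) (basis_vec c) = 0" for c
        using that by (cases c) (auto simp: hv_bracket_def)
    qed
    then show ?thesis .
  qed
  have lookup_proj: "Poly_Mapping.lookup (hv_proj z) (TD x) = Poly_Mapping.lookup z (L x)"
    "Poly_Mapping.lookup (hv_proj z) (T x) = Poly_Mapping.lookup z (I x)" for x
  proof -
    have "Poly_Mapping.lookup (hv_basis_proj b) (TD x) = ((1::'f) when b = L x)"
      "Poly_Mapping.lookup (hv_basis_proj b) (T x) = ((1::'f) when b = I x)" for b
      by (cases b; simp add: lookup_single)+
    then show "Poly_Mapping.lookup (hv_proj z) (TD x) = Poly_Mapping.lookup z (L x)"
      "Poly_Mapping.lookup (hv_proj z) (T x) = Poly_Mapping.lookup z (I x)"
      by (simp_all add: hv_proj_def linear_ext_def lookup_sum when_def in_keys_iff if_distrib[of "\<lambda>c. _ * c"]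
          cong: if_cong)
  qed
  have keys: "b \<in> {C_L, C_I, C_LI}" if "b \<in> Poly_Mapping.keys z" for b
    using that lookup_proj assms by (cases b) (auto simp: in_keys_iff)
  have "Vector_Spaces.linear free_scale free_scale (\<lambda>z. hv_bracket d z u)"
    using bilinear_bilinear_ext[of "hv_basis_bracket d"] by (simp add: hv_bracket_def bilinear_map_def)
  from linear_free_expansion[OF this, of z] show ?thesis
    using zero keys by (simp cong: sum.cong)
qed

lemma central_extension_hv:
  fixes d :: "'a::ab_group_add \<Rightarrow> 'f::field_char_0"
  assumes "additive d"
  shows "central_extension free_scale (hv_bracket d) free_scale (d1_bracket d) hv_proj"
proof (intro central_extension.intro central_extension_axioms.intro lie_algebra_hom.intro
    lie_algebra_hom_axioms.intro)
  show "lie_algebra free_scale (hv_bracket d)" by (rule lie_algebra_hv) fact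
  then show "lie_algebra free_scale (d1_bracket d)"
    using linear_hv_proj surj_hv_proj bilinear_bilinear_ext[of "d1_basis_bracket d"]
    unfolding d1_bracket_def[symmetric]
    by (rule lie_algebra_surj_image) (rule hv_proj_bracket, fact)
  show "Vector_Spaces.linear free_scale free_scale (hv_proj :: ('a hv_basis \<Rightarrow>\<^sub>0 'f) \<Rightarrow> _)"
    by (rule linear_hv_proj)
  show "hv_proj (hv_bracket d u v) = d1_bracket d (hv_proj u) (hv_proj v)" for u v
    by (rule hv_proj_bracket) fact
qed (rule surj_hv_proj hv_proj_kernel_central, assumption?)+

section \<open>Vanishing of normalized cocycles\<close>

lemma (in vector_space) scale_eq_0_cancel: "scale k v = scale l v \<Longrightarrow> k \<noteq> l \<Longrightarrow> v = 0"
  by (simp add: scale_cancel_right)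

text \<open>The equation at \<open>(x, y)\<close>, \<open>(x + y, y)\<close> and
  \<open>(x, y + y)\<close> gives three homogeneous relations between \<open>f x\<close>,
  \<open>f (x + y)\<close> and \<open>f (x + (y + y))\<close>. Eliminating the last two leaves two
  multiples of \<open>f x\<close> whose coefficients differ by 12 times the cube of
  \<open>d y\<close>. The hypothesis on 12 expresses what is needed of the characteristic.\<close>

lemma (in vector_space) virasoro_cocycle_vanishes:
  fixes d :: "'c::ab_group_add \<Rightarrow> 'a" and f :: "'c \<Rightarrow> 'b"
  assumes "additive d" "(12::'a) \<noteq> 0" "d y \<noteq> 0" "f y = 0" "f (y + y) = 0"
    and eq: "\<And>x y. scale (d x + 2 * d y) (f x) - scale (2 * d x + d y) (f y)
      = scale (d x - d y) (f (x + y))"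
  shows "f x = 0"
proof -
  interpret d: additive d by fact
  define a p where "a = d y" and "p = d x"
  have 1: "scale (p + 2 * a) (f x) = scale (p - a) (f (x + y))"
    using eq[of x y] assms by (simp add: a_def p_def)
  have 2: "scale (p + 3 * a) (f (x + y)) = scale p (f (x + (y + y)))"
    using eq[of "x + y" y] assms by (simp add: a_def p_def d.add add.assoc algebra_simps)
  have 3: "scale (p + 4 * a) (f x) = scale (p - 2 * a) (f (x + (y + y)))"
    using eq[of x "y + y"] assms by (simp add: a_def p_def d.add flip: mult_2)
  have "scale ((p + 3 * a) * (p - 2 * a) * (p + 2 * a)) (f x)
      = scale ((p + 3 * a) * (p - 2 * a)) (scale (p - a) (f (x + y)))"
    by (simp only: scale_scale flip: 1)
  also have "\<dots> = scale ((p - 2 * a) * (p - a)) (scale (p + 3 * a) (f (x + y)))"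
    by (simp add: ac_simps)
  also have "\<dots> = scale ((p - a) * p) (scale (p - 2 * a) (f (x + (y + y))))"
    by (simp only: 2) (simp add: ac_simps)
  also have "\<dots> = scale ((p - a) * p * (p + 4 * a)) (f x)"
    by (simp only: scale_scale flip: 3)
  finally show ?thesis
  proof (rule scale_eq_0_cancel)
    have "(p - a) * p * (p + 4 * a) - (p + 3 * a) * (p - 2 * a) * (p + 2 * a) = 12 * (a * a * a)"
      by (simp add: algebra_simps)
    moreover have "12 * (a * a * a) \<noteq> 0"
      using assms unfolding a_def by simp
    ultimately show "(p + 3 * a) * (p - 2 * a) * (p + 2 * a) \<noteq> (p - a) * p * (p + 4 * a)"
      by (metis cancel_comm_monoid_add_class.diff_cancel)
  qed
qed

text \<open>The elimination is the same as for the Virasoro equation, but with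
  \<open>a = d y\<close> the two coefficients of \<open>f x\<close> now differ by
  \<open>(d x + 2 * a) * (2 * (a * a))\<close>. The case \<open>d x + 2 * a = 0\<close> is therefore
  separate.\<close>

lemma (in vector_space) mixed_cocycle_vanishes:
  fixes d :: "'c::ab_group_add \<Rightarrow> 'a" and f :: "'c \<Rightarrow> 'b"
  assumes "additive d" "(2::'a) \<noteq> 0" "\<And>x. d x = 0 \<Longrightarrow> x = 0"
    "d y \<noteq> 0" "f y = 0" "f (y + y) = 0"
    and eq: "\<And>x y. scale (d x + d y) (f x - f y) = scale (d x - d y) (f (x + y))"
  shows "f x = 0"
proof -
  interpret d: additive d by fact
  define a where "a = d y"
  have "a \<noteq> 0" using assms a_def by simp
  have *: "f x = 0" if "d x + 2 * a \<noteq> 0" for x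
  proof -
    define p where "p = d x"
    have 1: "scale (p + a) (f x) = scale (p - a) (f (x + y))"
      using eq[of x y] assms by (simp add: a_def p_def)
    have 2: "scale (p + 2 * a) (f (x + y)) = scale p (f (x + (y + y)))"
      using eq[of "x + y" y] assms by (simp add: a_def p_def d.add add.assoc flip: mult_2)
    have 3: "scale (p + 2 * a) (f x) = scale (p - 2 * a) (f (x + (y + y)))"
      using eq[of x "y + y"] assms by (simp add: a_def p_def d.add flip: mult_2)
    have "scale ((p + 2 * a) * (p - 2 * a) * (p + a)) (f x)
        = scale ((p + 2 * a) * (p - 2 * a)) (scale (p - a) (f (x + y)))"
      by (simp only: scale_scale flip: 1)
    also have "\<dots> = scale ((p - 2 * a) * (p - a)) (scale (p + 2 * a) (f (x + y)))"
      by (simp add: ac_simps)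
    also have "\<dots> = scale ((p - a) * p) (scale (p - 2 * a) (f (x + (y + y))))"
      by (simp only: 2) (simp add: ac_simps)
    also have "\<dots> = scale ((p - a) * p * (p + 2 * a)) (f x)"
      by (simp only: scale_scale flip: 3)
    finally show ?thesis
    proof (rule scale_eq_0_cancel)
      have "(p - a) * p * (p + 2 * a) - (p + 2 * a) * (p - 2 * a) * (p + a) = (p + 2 * a) * (2 * (a * a))"
        by (simp add: algebra_simps)
      moreover have "(p + 2 * a) * (2 * (a * a)) \<noteq> 0"
        using assms that unfolding a_def p_def by simp
      ultimately show "(p + 2 * a) * (p - 2 * a) * (p + a) \<noteq> (p - a) * p * (p + 2 * a)"
        by (metis cancel_comm_monoid_add_class.diff_cancel)
    qed
  qed
  show ?thesis
  proof (cases "d x + 2 * a = 0")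
    \<comment> \<open>The elimination fails at \<open>x\<close> but applies at \<open>x + y\<close>,
      since \<open>d (x + y) + 2 * a = a\<close>. The equation at \<open>(x, y)\<close> then carries
      the vanishing back to \<open>x\<close>, the coefficient \<open>d x + a\<close> being
      nonzero.\<close>
    case True
    then have "d (x + (y + y)) = 0"
      by (simp add: d.add a_def flip: mult_2)
    then have xy: "x + (y + y) = 0" by (rule assms(3))
    have "f (x + y) = 0"
    proof (rule *)
      have "d (x + y) + 2 * a = a" using True by (simp add: d.add a_def add.commute)
      then show "d (x + y) + 2 * a \<noteq> 0" using \<open>a \<noteq> 0\<close> by (simp only: not_False_eq_True)
    qed
    then have "scale (d x + a) (f x) = 0"
      using eq[of x y] assms by (simp add: a_def)
    moreover have "d x + a \<noteq> 0"
    proof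
      assume "d x + a = 0"
      moreover have "a = (d x + 2 * a) - (d x + a)" by simp
      ultimately have "a = 0" using True by simp
      with \<open>a \<noteq> 0\<close> show False by simp
    qed
    ultimately show ?thesis by simp
  qed (rule *)
qed

section \<open>Lifting to a central extension\<close>

lemma (in lie_algebra) bilinear_map_bracket: "bilinear_map scale scale bracket"
  using linear_left linear_right by (simp add: bilinear_map_def)

lemma (in lie_algebra) bracket_antisym: "bracket x y = - bracket y x"
proof -
  note B = bilinear_map_simps[OF bilinear_map_bracket]
  have "0 = bracket (x + y) (x + y)" by (rule alternating [symmetric])
  also have "\<dots> = bracket x y + bracket y x"
    by (simp only: B) (simp add: alternating)
  finally show ?thesis by (simp only: eq_neg_iff_add_eq_0)
qed

text \<open>Changing an argument within its fibre adds an element of the kernel, which is central.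
  Brackets of lifts are thus independent of the chosen lifts.\<close>

lemma (in central_extension) bracket_cong:
  assumes "p u = p u'" "p v = p v'"
  shows "bE u v = bE u' v'"
proof -
  note B = bilinear_map_simps[OF dom.bilinear_map_bracket]
  have central: "bE z w = 0" "bE w z = 0" if "p z = 0" for z w
    using kernel_central[OF that] dom.bracket_antisym[of w z] by simp_all
  have "bE u v - bE u' v = bE (u - u') v" by (simp add: B)
  also have "\<dots> = 0" by (rule central) (simp add: diff assms)
  finally have "bE u v = bE u' v" by simp
  also have "bE u' v - bE u' v' = bE u' (v - v')" by (simp add: B)
  then have "bE u' v - bE u' v' = 0" using central[of "v - v'"] by (simp add: diff assms)
  then have "bE u' v = bE u' v'" by simp
  finally show ?thesis .
qed

text \<open>Turns the three-term cocycle identity into the shape of the functional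
  equations.\<close>

lemma neg_add_add_eq_0D: "- a + b + c = 0 \<Longrightarrow> a - b = (c :: 'z::ab_group_add)"
  by (metis add.assoc add_eq_0_iff diff_eq_eq add.commute minus_minus)

text \<open>The nonzero \<open>y\<close> is an auxiliary choice: the images of \<open>L 0\<close>,
  \<open>I 0\<close> and of the central elements are determined by relations at \<open>y\<close> and
  \<open>y + y\<close>.\<close>

locale hv_extension = central_extension sE bE free_scale "d1_bracket d" q + d: additive d
  for sE :: "'f::field_char_0 \<Rightarrow> 'e::ab_group_add \<Rightarrow> 'e" and bE :: "'e \<Rightarrow> 'e \<Rightarrow> 'e"
    and d :: "'a::ab_group_add \<Rightarrow> 'f" and q :: "('e \<Rightarrow> ('a d1_basis \<Rightarrow>\<^sub>0 'f))" +
  fixes y :: 'a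
  assumes d_nonzero: "x \<noteq> 0 \<Longrightarrow> d x \<noteq> 0" and y_nonzero: "y \<noteq> 0"
begin

sublocale hv: central_extension free_scale "hv_bracket d" free_scale "d1_bracket d" hv_proj
  by (rule central_extension_hv) (rule d.additive_axioms)

lemmas bE_simps = bilinear_map_simps[OF dom.bilinear_map_bracket]
lemmas hv_simps = bilinear_map_simps[OF hv.dom.bilinear_map_bracket]
lemmas d_simps = d.add d.diff d.minus d.zero

lemma dy_nonzero: "d y \<noteq> 0"
  by (rule d_nonzero) (rule y_nonzero)

lemma y2_nonzero: "y + y \<noteq> 0"
proof
  assume "y + y = 0"
  then have "2 * d y = 0" by (metis d.add d.zero mult_2)
  with dy_nonzero show False by simp
qed

section \<open>Images of the basis vectors in a central extension\<close>

definition lift :: "'a d1_basis \<Rightarrow> 'e" where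
  "lift b = inv q (basis_vec b)"

lemma q_lift: "q (lift b) = basis_vec b"
  unfolding lift_def by (rule surj_f_inv_f) (rule surj_proj)

text \<open>Eigenvectors of \<open>ad (lift (TD 0))\<close> over the eigenvectors of \<open>ad (t\<^sup>0\<partial>)\<close> of nonzero weight;
  they do not depend on the choice of lifts.\<close>

definition eL :: "'a \<Rightarrow> 'e" where
  "eL x = sE (1 / d x) (bE (lift (TD 0)) (lift (TD x)))"

definition eI :: "'a \<Rightarrow> 'e" where
  "eI x = sE (1 / d x) (bE (lift (TD 0)) (lift (T x)))"

text \<open>Obtained by subtracting twice the desired relation for \<open>[L(y), L(-y)]\<close> from
  the one for \<open>[L(2y), L(-2y)]\<close>. The image of \<open>L 0\<close> drops out, and
  \<open>C_L\<close> is left with coefficient \<open>d y ^ 3 / 2\<close>.\<close>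

definition cL :: 'e where
  "cL = sE (2 / d y ^ 3) (bE (eL (y + y)) (eL (- (y + y))) - sE 2 (bE (eL y) (eL (- y))))"

text \<open>The same elimination, now of the image of \<open>I 0\<close> from the relations for
  \<open>[L(y), I(-y)]\<close> and \<open>[L(2y), I(-2y)]\<close>; the remaining coefficient is
  \<open>2 * d y ^ 2\<close>.\<close>

definition cLI :: 'e where
  "cLI = sE (1 / (2 * d y ^ 2)) (bE (eL (y + y)) (eI (- (y + y))) - sE 2 (bE (eL y) (eI (- y))))"

text \<open>The values at \<open>L 0\<close>, \<open>I 0\<close> and \<open>C_I\<close> solve the
  relations for \<open>[L(y), L(-y)]\<close>, \<open>[L(y), I(-y)]\<close> and
  \<open>[I(y), I(-y)]\<close>.\<close>

fun gen :: "'a hv_basis \<Rightarrow> 'e" where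
  "gen (L x) = (if x = 0 then sE (1 / (2 * d y)) (sE ((d y ^ 3 - d y) / 12) cL - bE (eL y) (eL (- y)))
     else eL x)"
| "gen (I x) = (if x = 0 then sE (1 / d y) (sE (d y ^ 2 - d y) cLI - bE (eL y) (eI (- y)))
     else eI x)"
| "gen C_L = cL"
| "gen C_I = sE (- 1 / d y) (bE (eI y) (eI (- y)))"
| "gen C_LI = cLI"

lemma gen_nonzero: "x \<noteq> 0 \<Longrightarrow> gen (L x) = eL x" "x \<noteq> 0 \<Longrightarrow> gen (I x) = eI x"
  by simp_all

definition h :: "('a hv_basis \<Rightarrow>\<^sub>0 'f) \<Rightarrow> 'e" where
  "h = free_ext sE gen"

lemma linear_h: "Vector_Spaces.linear free_scale sE h"
  unfolding h_def by (rule linear_free_ext) unfold_locales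

lemmas h_simps = linear_simps[OF linear_h]

lemma h_single: "h (Poly_Mapping.single b k) = sE k (gen b)"
  using h_simps(2)[of k "basis_vec b"] by (simp add: h_def dom.vector_space_axioms)

lemma d1_singles: "d1_bracket d (Poly_Mapping.single b k) (Poly_Mapping.single c l)
    = free_scale (k * l) (d1_basis_bracket d b c)"
  unfolding d1_bracket_def by (rule bilinear_ext_singles)

lemma q_eL: "x \<noteq> 0 \<Longrightarrow> q (eL x) = basis_vec (TD x)"
  using d_nonzero[of x] by (simp add: eL_def scale hom_bracket q_lift d1_singles d_simps)

lemma q_eI: "x \<noteq> 0 \<Longrightarrow> q (eI x) = basis_vec (T x)"
  using d_nonzero[of x] by (simp add: eI_def scale hom_bracket q_lift d1_singles d_simps)

lemma q_bracket_eL: "x \<noteq> 0 \<Longrightarrow> q (bE (eL x) (eL (- x))) = Poly_Mapping.single (TD 0) (- 2 * d x)"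
  by (simp add: hom_bracket q_eL d1_singles d_simps)

lemma q_bracket_eL_eI: "x \<noteq> 0 \<Longrightarrow> q (bE (eL x) (eI (- x))) = Poly_Mapping.single (T 0) (- d x)"
  by (simp add: hom_bracket q_eL q_eI d1_singles d_simps)

lemma q_bracket_eI: "x \<noteq> 0 \<Longrightarrow> q (bE (eI x) (eI (- x))) = 0"
  by (simp add: hom_bracket q_eI d1_singles)

text \<open>The multiples of \<open>TD 0\<close> cancel, namely \<open>- 4 * d y\<close> against
  twice \<open>- 2 * d y\<close>. Hence \<open>cL\<close> lies in the kernel and is central.\<close>

lemma q_cL: "q cL = 0"
  by (simp only: cL_def scale diff q_bracket_eL [OF y_nonzero] q_bracket_eL [OF y2_nonzero]
      free_scale_single flip: single_diff)
     (simp add: d_simps)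

lemma q_cLI: "q cLI = 0"
  by (simp only: cLI_def scale diff q_bracket_eL_eI [OF y_nonzero] q_bracket_eL_eI [OF y2_nonzero]
      free_scale_single flip: single_diff)
     (simp add: d_simps)

lemma q_gen: "q (gen b) = hv_basis_proj b"
proof (cases b)
  case (L x)
  then show ?thesis
    using y_nonzero dy_nonzero
    by (simp add: q_eL q_cL scale diff q_bracket_eL flip: single_uminus)
next
  case (I x)
  then show ?thesis
    using y_nonzero dy_nonzero
    by (simp add: q_eI q_cLI scale diff q_bracket_eL_eI flip: single_uminus)
qed (simp_all add: q_cL q_cLI scale neg q_bracket_eI y_nonzero)

lemma q_h: "q (h u) = hv_proj u"
proof (rule linear_free_eqI[where s = free_scale and f = "\<lambda>u. q (h u)"])
  show "Vector_Spaces.linear free_scale free_scale (\<lambda>u. q (h u))"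
    using Vector_Spaces.linear_compose[OF linear_h linear_axioms] by (simp only: o_def)
  show "q (h (basis_vec b)) = hv_proj (basis_vec b)" for b
    by (simp add: h_single q_gen hv_proj_def)
qed (rule linear_hv_proj)

section \<open>The defect of the lift as a 2-cocycle\<close>

definition defect :: "('a hv_basis \<Rightarrow>\<^sub>0 'f) \<Rightarrow> ('a hv_basis \<Rightarrow>\<^sub>0 'f) \<Rightarrow> 'e" where
  "defect u v = bE (h u) (h v) - h (hv_bracket d u v)"

definition bdefect :: "'a hv_basis \<Rightarrow> 'a hv_basis \<Rightarrow> 'e" where
  "bdefect b c = defect (basis_vec b) (basis_vec c)"

lemma bilinear_defect: "bilinear_map free_scale sE defect"
  by (rule bilinear_mapI)
    (simp_all add: defect_def bE_simps hv_simps h_simps dom.scale_right_diff_distrib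
      vector_space_free_scale dom.vector_space_axioms)

lemmas defect_simps = bilinear_map_simps[OF bilinear_defect]

lemma defect_single:
  "defect (Poly_Mapping.single b k) (Poly_Mapping.single c l) = sE (k * l) (bdefect b c)"
proof -
  have "defect (free_scale k (basis_vec b)) (free_scale l (basis_vec c)) = sE (k * l) (bdefect b c)"
    unfolding bdefect_def by (simp only: defect_simps dom.scale_scale mult.commute)
  then show ?thesis by simp
qed

lemma defect_antisym: "defect u v = - defect v u"
  using dom.bracket_antisym[of "h u" "h v"] hv.dom.bracket_antisym[of u v]
  by (simp add: defect_def h_simps)

lemma bdefect_antisym: "bdefect b c = - bdefect c b"
  unfolding bdefect_def by (rule defect_antisym)

lemma bdefect_eq:
  "bdefect b c = bE (gen b) (gen c) - h (hv_basis_bracket d b c)"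
  by (simp add: bdefect_def defect_def h_single hv_bracket_def)

text \<open>The elements \<open>h (hv_bracket d v w)\<close> and \<open>bE (h v) (h w)\<close> lie
  over the same point, so they have the same brackets in the extension. The sum then splits into a
  Jacobi sum in the extension minus the image under \<open>h\<close> of a Jacobi sum.\<close>

lemma defect_cocycle:
  "defect u (hv_bracket d v w) + defect v (hv_bracket d w u) + defect w (hv_bracket d u v) = 0"
proof -
  have "bE (h u) (h (hv_bracket d v w)) = bE (h u) (bE (h v) (h w))" for u v w
    by (rule bracket_cong) (simp_all add: q_h hom_bracket hv.hom_bracket)
  then have "defect u (hv_bracket d v w) + defect v (hv_bracket d w u) + defect w (hv_bracket d u v)
     = (bE (h u) (bE (h v) (h w)) + bE (h v) (bE (h w) (h u)) + bE (h w) (bE (h u) (h v)))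
     - h (hv_bracket d u (hv_bracket d v w) + hv_bracket d v (hv_bracket d w u)
       + hv_bracket d w (hv_bracket d u v))"
    by (simp add: defect_def h_simps)
  then show ?thesis
    by (simp add: dom.jacobi hv.dom.jacobi h_simps)
qed

lemma hv_bracket_basis: "hv_bracket d (basis_vec b) (basis_vec c) = hv_basis_bracket d b c"
  unfolding hv_bracket_def by (rule bilinear_ext_single)

lemma defect_central:
  assumes "hv_basis_proj c = (0 :: 'a d1_basis \<Rightarrow>\<^sub>0 'f)"
  shows "bdefect b c = 0"
proof -
  have c: "hv_proj (basis_vec c) = (0 :: 'a d1_basis \<Rightarrow>\<^sub>0 'f)"
    using assms by (simp add: hv_proj_def)
  have "bE (h (basis_vec c)) (h (basis_vec b)) = 0"
    by (rule kernel_central) (simp add: q_h c)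
  moreover have "hv_bracket d (basis_vec c) (basis_vec b) = 0"
    by (rule hv_proj_kernel_central) (rule c)
  ultimately have "bdefect c b = 0"
    by (simp add: bdefect_def defect_def h_simps)
  then show ?thesis by (subst bdefect_antisym) simp
qed

lemma defect_C [simp]: "bdefect b C_L = 0" "bdefect b C_I = 0" "bdefect b C_LI = 0"
  by (simp_all add: defect_central)

lemmas cocycle_basis = defect_cocycle[of "basis_vec b" "basis_vec c" "basis_vec e" for b c e,
    unfolded hv_bracket_basis]

section \<open>Weights and the invariance of the defect under \<open>L 0\<close>\<close>

text \<open>The eigenvalue of \<open>ad (L 0)\<close> on a basis vector, as
  \<open>bracket_L0\<close> records.\<close>

fun weight :: "'a hv_basis \<Rightarrow> 'f" where
  "weight (L x) = d x"
| "weight (I x) = d x"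
| "weight _ = 0"

lemma bracket_L0: "hv_basis_bracket d (L 0) b = Poly_Mapping.single b (weight b)"
  by (cases b) (simp_all add: d_simps)

lemma bracket_L0_right: "hv_basis_bracket d b (L 0) = - Poly_Mapping.single b (weight b)"
  by (cases b) (auto simp add: d_simps simp flip: single_uminus)

text \<open>For nonzero index the images are eigenvectors by choice. The pair
  \<open>(L 0, L 0)\<close> is settled by alternation, and \<open>(L 0, I 0)\<close> by the cocycle
  identity.\<close>

lemma defect_L0: "bdefect (L 0) b = 0"
proof -
  \<comment> \<open>Both elements lie over \<open>TD 0\<close>, so \<open>gen (L 0)\<close> acts
    like the lift used to define \<open>eL\<close> and \<open>eI\<close>.\<close>
  have gen0: "bE (gen (L 0)) v = bE (lift (TD 0)) v" for v
    by (rule bracket_cong) (simp_all only: q_gen q_lift hv_basis_proj.simps)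
  have eigen: "bE (gen (L 0)) (gen b) = sE (weight b) (gen b)"
    if "b = L x \<or> b = I x" "x \<noteq> 0" for b x
  proof -
    define c where "c = (if b = L x then TD x else T x)"
    have c: "gen b = sE (1 / d x) (bE (lift (TD 0)) (lift c))" "q (gen b) = basis_vec c"
      "weight b = d x"
      using that q_eL[of x] q_eI[of x] by (auto simp: c_def eL_def eI_def)
    have "bE (gen (L 0)) (gen b) = bE (lift (TD 0)) (lift c)"
      unfolding gen0 by (rule bracket_cong) (simp_all only: c(2) q_lift)
    also have "\<dots> = sE (weight b) (gen b)"
      using d_nonzero[OF that(2)] by (simp add: c(1,3))
    finally show ?thesis .
  qed
  have nz: "bdefect (L 0) b = 0" if "b = L x \<or> b = I x" "x \<noteq> 0" for b x
    using eigen[OF that] by (simp add: bdefect_eq bracket_L0 h_single del: gen.simps)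
  have ny: "- y \<noteq> 0" using y_nonzero by simp
  have "bdefect (L 0) (L 0) = 0"
    by (simp add: bdefect_def defect_def dom.alternating hv.dom.alternating h_simps)
  moreover have "bdefect (L 0) (I 0) = 0"
  proof -
    \<comment> \<open>The vector \<open>I 0\<close> is reached through the bracket of
      \<open>L y\<close> and \<open>I (- y)\<close>. These have opposite weights, so the two other
      terms of the cocycle identity cancel.\<close>
    let ?w = "bdefect (L y) (I (- y))"
    have "defect (basis_vec (L 0)) (hv_basis_bracket d (L y) (I (- y)))
        = - sE (d y) (bdefect (L 0) (I 0))"
      by (simp add: defect_simps defect_single d_simps)
    moreover have "defect (basis_vec (L y)) (hv_basis_bracket d (I (- y)) (L 0)) = sE (d y) ?w"
      by (simp add: bracket_L0_right defect_simps defect_single d_simps)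
    moreover have "defect (basis_vec (I (- y))) (hv_basis_bracket d (L 0) (L y)) = - sE (d y) ?w"
      unfolding bracket_L0 defect_single bdefect_antisym[of "I (- y)"] by simp
    ultimately have "sE (d y) (bdefect (L 0) (I 0)) = 0"
      using cocycle_basis[of "L 0" "L y" "I (- y)"] by simp
    then show ?thesis using dy_nonzero by simp
  qed
  ultimately show ?thesis
    using nz by (cases b) (metis defect_C)+
qed

text \<open>Since the defect vanishes against \<open>L 0\<close>, the cocycle identity for
  \<open>L 0\<close>, \<open>b\<close>, \<open>c\<close> says that
  \<open>weight b + weight c\<close> annihilates \<open>bdefect b c\<close>.\<close>

lemma defect_weight:
  assumes "weight b + weight c \<noteq> 0"
  shows "bdefect b c = 0"
proof -
  have L0: "defect (basis_vec (L 0)) u = 0" for u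
  proof (rule linear_free_eqI[where s = sE and f = "defect (basis_vec (L 0))" and g = "\<lambda>_. 0"])
    show "Vector_Spaces.linear free_scale sE (defect (basis_vec (L 0)))"
      using bilinear_defect by (simp add: bilinear_map_def)
    show "Vector_Spaces.linear free_scale sE (\<lambda>_. 0)"
      by (simp add: Vector_Spaces.linear_iff vector_space_free_scale dom.vector_space_axioms)
    show "defect (basis_vec (L 0)) (basis_vec b) = 0" for b
      using defect_L0 by (simp add: bdefect_def)
  qed
  have "defect (basis_vec b) (hv_basis_bracket d c (L 0)) = - sE (weight c) (bdefect b c)"
    by (simp add: bracket_L0_right defect_simps defect_single)
  moreover have "defect (basis_vec c) (hv_basis_bracket d (L 0) b) = - sE (weight b) (bdefect b c)"
    unfolding bracket_L0 defect_single bdefect_antisym[of c] by simp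
  ultimately have "- sE (weight c) (bdefect b c) - sE (weight b) (bdefect b c) = 0"
    using cocycle_basis[of "L 0" b c] by (simp add: L0)
  then have "- sE (weight b + weight c) (bdefect b c) = 0"
    by (simp add: dom.scale_left_distrib)
  then show ?thesis using assms by simp
qed

section \<open>Vanishing of the defect on pairs of opposite weight\<close>

lemma double: "d (y + y) = 2 * d y"
  by (simp add: d.add)

text \<open>The choice of \<open>gen (L 0)\<close> makes the defect 0 at \<open>y\<close>, and that
  of \<open>cL\<close> makes it 0 at \<open>y + y\<close>. The functional equation is the cocycle
  identity for \<open>L x\<close>, \<open>L z\<close>, \<open>L (- (x + z))\<close>.\<close>

lemma defect_L_L: "bdefect (L x) (L (- x)) = 0"
proof (rule dom.virasoro_cocycle_vanishes[where d = d and y = y and f = "\<lambda>x. bdefect (L x) (L (- x))"])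
  have *: "bdefect (L x) (L (- x))
      = bE (eL x) (eL (- x)) + sE (2 * d x) (gen (L 0)) - sE ((d x ^ 3 - d x) / 12) cL"
    if "x \<noteq> 0" for x
    using that by (simp add: bdefect_eq h_simps h_single d_simps gen_nonzero del: gen.simps(1))
  show "bdefect (L y) (L (- y)) = 0"
    unfolding *[OF y_nonzero] using dy_nonzero by (simp add: dom.scale_right_diff_distrib)
  show "bdefect (L (y + y)) (L (- (y + y))) = 0"
  proof -
    let ?u = "bE (eL y) (eL (- y))"
    \<comment> \<open>\<open>u2\<close> is the definition of \<open>cL\<close> solved for the
      bracket at \<open>y + y\<close>, and \<open>g0\<close> is that of \<open>gen (L 0)\<close>
      scaled by \<open>4 * d y\<close>; by \<open>k\<close> all terms in \<open>cL\<close> and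
      \<open>?u\<close> cancel.\<close>
    have u2: "bE (eL (y + y)) (eL (- (y + y))) = sE (d y ^ 3 / 2) cL + sE 2 ?u"
      using dy_nonzero by (simp add: cL_def del: minus_add_distrib)
    have g0: "sE (2 * (2 * d y)) (gen (L 0)) = sE (2 * ((d y ^ 3 - d y) / 12)) cL - sE 2 ?u"
      using dy_nonzero by (simp add: dom.scale_right_diff_distrib)
    have k: "d y ^ 3 / 2 + 2 * ((d y ^ 3 - d y) / 12) = ((2 * d y) ^ 3 - 2 * d y) / 12"
      by (simp add: field_simps)
    show ?thesis
      unfolding *[OF y2_nonzero] double u2 g0 k[symmetric] dom.scale_left_distrib by simp
  qed
  fix x z
  show "sE (d x + 2 * d z) (bdefect (L x) (L (- x))) - sE (2 * d x + d z) (bdefect (L z) (L (- z)))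
     = sE (d x - d z) (bdefect (L (x + z)) (L (- (x + z))))"
  proof -
    let ?w = "\<lambda>x. bdefect (L x) (L (- x))"
    \<comment> \<open>The central summands of the inner brackets drop out by
      \<open>defect_C\<close>.\<close>
    have "defect (basis_vec (L x)) (hv_basis_bracket d (L z) (L (- (x + z))))
        = - sE (d x + 2 * d z) (?w x)"
      by (simp add: defect_simps defect_single d_simps flip: dom.scale_minus_left)
    moreover have "defect (basis_vec (L z)) (hv_basis_bracket d (L (- (x + z))) (L x))
        = sE (2 * d x + d z) (?w z)"
      by (simp add: defect_simps defect_single d_simps)
    moreover have "defect (basis_vec (L (- (x + z)))) (hv_basis_bracket d (L x) (L z))
        = sE (d x - d z) (?w (x + z))"
      unfolding hv_basis_bracket.simps defect_simps defect_single defect_C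
        bdefect_antisym[of "L (- (x + z))"]
      by (simp add: d_simps flip: dom.scale_minus_left)
    ultimately show ?thesis
      using cocycle_basis[of "L x" "L z" "L (- (x + z))"] by (intro neg_add_add_eq_0D) (simp only:)
  qed
qed (use dy_nonzero d.additive_axioms in auto)

text \<open>Here \<open>gen (I 0)\<close> and \<open>cLI\<close> give the zeros at \<open>y\<close>
  and \<open>y + y\<close>, and the cocycle identity for \<open>L x\<close>, \<open>L z\<close>,
  \<open>I (- (x + z))\<close> gives the mixed equation.\<close>

lemma defect_L_I: "bdefect (L x) (I (- x)) = 0"
proof (rule dom.mixed_cocycle_vanishes[where d = d and y = y and f = "\<lambda>x. bdefect (L x) (I (- x))"])
  have *: "bdefect (L x) (I (- x))
      = bE (eL x) (eI (- x)) + sE (d x) (gen (I 0)) - sE (d x ^ 2 - d x) cLI"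
    if "x \<noteq> 0" for x
    using that by (simp add: bdefect_eq h_simps h_single d_simps gen_nonzero del: gen.simps(2))
  show "bdefect (L y) (I (- y)) = 0"
    unfolding *[OF y_nonzero] using dy_nonzero by (simp add: dom.scale_right_diff_distrib)
  show "bdefect (L (y + y)) (I (- (y + y))) = 0"
  proof -
    let ?u = "bE (eL y) (eI (- y))"
    have u2: "bE (eL (y + y)) (eI (- (y + y))) = sE (2 * d y ^ 2) cLI + sE 2 ?u"
      using dy_nonzero by (simp add: cLI_def del: minus_add_distrib)
    have g0: "sE (2 * d y) (gen (I 0)) = sE (2 * (d y ^ 2 - d y)) cLI - sE 2 ?u"
      using dy_nonzero by (simp add: dom.scale_right_diff_distrib)
    have k: "2 * d y ^ 2 + 2 * (d y ^ 2 - d y) = (2 * d y) ^ 2 - 2 * d y"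
      by (simp add: field_simps)
    show ?thesis
      unfolding *[OF y2_nonzero] double u2 g0 k[symmetric] dom.scale_left_distrib by simp
  qed
  fix x z
  show "sE (d x + d z) (bdefect (L x) (I (- x)) - bdefect (L z) (I (- z)))
     = sE (d x - d z) (bdefect (L (x + z)) (I (- (x + z))))"
  proof -
    let ?w = "\<lambda>x. bdefect (L x) (I (- x))"
    have "defect (basis_vec (L x)) (hv_basis_bracket d (L z) (I (- (x + z))))
        = - sE (d x + d z) (?w x)"
      by (simp add: defect_simps defect_single d_simps flip: dom.scale_minus_left)
    moreover have "defect (basis_vec (L z)) (hv_basis_bracket d (I (- (x + z))) (L x))
        = sE (d x + d z) (?w z)"
      by (simp add: defect_simps defect_single d_simps flip: dom.scale_minus_left)
    moreover have "defect (basis_vec (I (- (x + z)))) (hv_basis_bracket d (L x) (L z))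
        = sE (d x - d z) (?w (x + z))"
      unfolding hv_basis_bracket.simps defect_simps defect_single defect_C
        bdefect_antisym[of "I (- (x + z))"]
      by (simp add: d_simps flip: dom.scale_minus_left)
    ultimately show ?thesis
      using cocycle_basis[of "L x" "L z" "I (- (x + z))"]
      unfolding dom.scale_right_diff_distrib by (intro neg_add_add_eq_0D) (simp only:)
  qed
qed (use dy_nonzero d.additive_axioms d_nonzero in auto)

text \<open>In the cocycle identity for \<open>I y\<close>, \<open>I x\<close>,
  \<open>L (- (y + x))\<close> the bracket of \<open>I y\<close> and \<open>I x\<close> is central.
  What remains makes \<open>d y\<close> times the defect at \<open>x\<close> equal to
  \<open>d x\<close> times the defect at \<open>y\<close>, which is 0 by the choice of
  \<open>gen C_I\<close>.\<close>

lemma defect_I_I: "bdefect (I x) (I (- x)) = 0"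
proof -
  have 0: "bdefect (I y) (I (- y)) = 0"
    using y_nonzero dy_nonzero
    by (simp add: bdefect_eq h_simps h_single d_simps)
  have "defect (basis_vec (I y)) (hv_basis_bracket d (I x) (L (- (y + x))))
      = - sE (d x) (bdefect (I y) (I (- y)))"
    by (simp add: defect_simps defect_single d_simps)
  moreover have "defect (basis_vec (I x)) (hv_basis_bracket d (L (- (y + x))) (I y))
      = sE (d y) (bdefect (I x) (I (- x)))"
    by (simp add: defect_simps defect_single d_simps)
  moreover have "defect (basis_vec (L (- (y + x)))) (hv_basis_bracket d (I y) (I x)) = 0"
    by (simp add: defect_single)
  ultimately have "sE (d y) (bdefect (I x) (I (- x))) = 0"
    using cocycle_basis[of "I y" "I x" "L (- (y + x))"] by (simp add: 0)
  then show ?thesis using dy_nonzero by simp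
qed

lemma defect_zero: "defect u v = 0"
proof (rule bilinear_free_eqI[OF bilinear_defect, where B' = "\<lambda>_ _. 0"])
  show "bilinear_map free_scale sE (\<lambda>_ _. 0)"
    by (rule bilinear_mapI) (simp_all add: vector_space_free_scale dom.vector_space_axioms)
  fix b c
  \<comment> \<open>By nondegeneracy, opposite weights force opposite indices.\<close>
  have neg: "z = - x" if "d x + d z = 0" for x z
    using that d_nonzero[of "x + z"] by (metis add_eq_0_iff d.add)
  have IL: "bdefect (I x) (L (- x)) = 0" for x
    using bdefect_antisym[of "I x"] defect_L_I[of "- x"] by simp
  have "bdefect b c = 0"
  proof (cases "weight b + weight c = 0")
    case True
    show ?thesis
    proof (cases "hv_basis_proj b = (0 :: 'a d1_basis \<Rightarrow>\<^sub>0 'f)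
        \<or> hv_basis_proj c = (0 :: 'a d1_basis \<Rightarrow>\<^sub>0 'f)")
      case True
      then show ?thesis
        using defect_central bdefect_antisym by (metis neg_equal_0_iff_equal)
    next
      case False
      then obtain x z where "b = L x \<or> b = I x" "c = L z \<or> c = I z"
        by (cases b; cases c) auto
      moreover from this have "z = - x" using neg True by auto
      ultimately show ?thesis
        using defect_L_L defect_L_I defect_I_I IL by auto
    qed
  qed (rule defect_weight)
  then show "defect (basis_vec b) (basis_vec c) = 0" by (simp only: bdefect_def)
qed

lemma lie_algebra_hom_h: "lie_algebra_hom free_scale (hv_bracket d) sE bE h"
proof (intro lie_algebra_hom.intro lie_algebra_hom_axioms.intro linear_h)
  show "h (hv_bracket d u v) = bE (h u) (h v)" for u v
    using defect_zero[of u v] by (simp add: defect_def)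
qed unfold_locales

section \<open>Perfectness and the uniqueness of lifts\<close>

text \<open>This is perfectness in dual form. Brackets with \<open>L 0\<close> give
  \<open>L x\<close> and \<open>I x\<close> for nonzero \<open>x\<close>; the relations at
  \<open>y\<close> and \<open>y + y\<close> give \<open>C_L\<close> and \<open>C_LI\<close>, and
  then \<open>L 0\<close> and \<open>I 0\<close>; the bracket of \<open>I y\<close> and
  \<open>I (- y)\<close> gives \<open>C_I\<close>.\<close>

lemma linear_eq_zero_if_bracket:
  assumes lin: "Vector_Spaces.linear free_scale sE f"
    and br: "\<And>u v. f (hv_bracket d u v) = 0"
  shows "f u = 0"
proof -
  note f = linear_simps[OF lin]
  define g where "g b = f (basis_vec b)" for b
  have f_single: "f (Poly_Mapping.single b k) = sE k (g b)" for b k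
    using f(2)[of k "basis_vec b"] by (simp add: g_def)
  have basis: "f (hv_basis_bracket d b c) = 0" for b c
    using br[of "basis_vec b" "basis_vec c"] by (simp add: hv_bracket_basis)
  have nz: "g (L x) = 0" "g (I x) = 0" if "x \<noteq> 0" for x
    using basis[of "L 0" "L x"] basis[of "L 0" "I x"] d_nonzero[OF that]
    by (simp_all only: bracket_L0 f_single weight.simps dom.scale_eq_0_iff simp_thms)
  have L: "sE (- 2 * d x) (g (L 0)) + sE ((d x ^ 3 - d x) / 12) (g C_L) = 0" for x
    using basis[of "L x" "L (- x)"] by (simp add: f f_single d_simps)
  have I: "sE (- d x) (g (I 0)) + sE (d x ^ 2 - d x) (g C_LI) = 0" for x
    using basis[of "L x" "I (- x)"] by (simp add: f f_single d_simps)
  \<comment> \<open>As in the definition of \<open>cL\<close>, the relation at \<open>y + y\<close>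
    minus twice the one at \<open>y\<close> eliminates \<open>g (L 0)\<close>.\<close>
  have CL: "g C_L = 0"
  proof -
    let ?l = "g (L 0)" and ?c = "g C_L"
    have "sE (- 2 * (2 * d y)) ?l + sE (((2 * d y) ^ 3 - 2 * d y) / 12) ?c
        - sE 2 (sE (- 2 * d y) ?l + sE ((d y ^ 3 - d y) / 12) ?c) = 0"
      using L[of y] L[of "y + y"] unfolding double by simp
    also have "sE (- 2 * (2 * d y)) ?l + sE (((2 * d y) ^ 3 - 2 * d y) / 12) ?c
        - sE 2 (sE (- 2 * d y) ?l + sE ((d y ^ 3 - d y) / 12) ?c)
        = sE (((2 * d y) ^ 3 - 2 * d y) / 12 - 2 * ((d y ^ 3 - d y) / 12)) ?c"
      by (simp add: dom.scale_right_distrib dom.scale_right_diff_distrib dom.scale_left_diff_distrib)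
    also have "((2 * d y) ^ 3 - 2 * d y) / 12 - 2 * ((d y ^ 3 - d y) / 12) = d y ^ 3 / 2"
      by (simp add: field_simps)
    finally show ?thesis using dy_nonzero by simp
  qed
  moreover have CLI: "g C_LI = 0"
  proof -
    let ?i = "g (I 0)" and ?c = "g C_LI"
    have "sE (- (2 * d y)) ?i + sE ((2 * d y) ^ 2 - 2 * d y) ?c
        - sE 2 (sE (- d y) ?i + sE (d y ^ 2 - d y) ?c) = 0"
      using I[of y] I[of "y + y"] unfolding double by simp
    also have "sE (- (2 * d y)) ?i + sE ((2 * d y) ^ 2 - 2 * d y) ?c
        - sE 2 (sE (- d y) ?i + sE (d y ^ 2 - d y) ?c)
        = sE ((2 * d y) ^ 2 - 2 * d y - 2 * (d y ^ 2 - d y)) ?c"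
      by (simp add: dom.scale_right_distrib dom.scale_right_diff_distrib dom.scale_left_diff_distrib)
        (simp flip: dom.scale_left_diff_distrib)
    also have "(2 * d y) ^ 2 - 2 * d y - 2 * (d y ^ 2 - d y) = 2 * d y ^ 2"
      by (simp add: field_simps)
    finally show ?thesis using dy_nonzero by simp
  qed
  moreover have "g (L 0) = 0" "g (I 0) = 0"
    using L[of y] I[of y] dy_nonzero by (simp_all add: CL CLI)
  moreover have "g C_I = 0"
    using basis[of "I y" "I (- y)"] dy_nonzero by (simp add: f_single d_simps)
  ultimately have "g b = 0" for b
    using nz by (cases b) metis+
  then show ?thesis
    using linear_free_expansion[OF lin, of u] by (simp add: g_def)
qed

text \<open>Two lifts have equal images under \<open>q\<close>, so by \<open>bracket_cong\<close>
  they agree on every bracket. Their difference is linear and vanishes on brackets, hence everywhere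
  by perfectness.\<close>

lemma lie_algebra_hom_unique:
  assumes "lie_algebra_hom free_scale (hv_bracket d) sE bE h1"
    "lie_algebra_hom free_scale (hv_bracket d) sE bE h2"
    and "\<And>u. q (h1 u) = q (h2 u)"
  shows "h1 = h2"
proof
  fix u
  interpret h1: lie_algebra_hom free_scale "hv_bracket d" sE bE h1 by fact
  interpret h2: lie_algebra_hom free_scale "hv_bracket d" sE bE h2 by fact
  have "h1 u - h2 u = 0"
  proof (rule linear_eq_zero_if_bracket[where f = "\<lambda>u. h1 u - h2 u"])
    show "Vector_Spaces.linear free_scale sE (\<lambda>u. h1 u - h2 u)"
      by (simp add: Vector_Spaces.linear_iff vector_space_free_scale dom.vector_space_axioms
        h1.add h2.add h1.scale h2.scale dom.scale_right_diff_distrib)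
    show "h1 (hv_bracket d u v) - h2 (hv_bracket d u v) = 0" for u v
      using bracket_cong[of "h1 u" "h2 u" "h1 v" "h2 v"] by (simp add: assms h1.hom_bracket h2.hom_bracket)
  qed
  then show "h1 u = h2 u" by simp
qed

end

theorem corollary3p2:
  fixes d :: "'a::ab_group_add \<Rightarrow> 'f::field_char_0"
  assumes "\<exists>x::'a. x \<noteq> 0"
    and "additive d"
    and "\<And>x. x \<noteq> 0 \<Longrightarrow> d x \<noteq> 0"
  shows "universal_central_extension TYPE('e::ab_group_add)
           free_scale (hv_bracket d) free_scale (d1_bracket d) hv_proj"
  unfolding universal_central_extension_def
proof (intro conjI allI impI)
  show "central_extension free_scale (hv_bracket d) free_scale (d1_bracket d) hv_proj"
    by (rule central_extension_hv) fact
  fix sE :: "'f \<Rightarrow> 'e \<Rightarrow> 'e" and bE q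
  assume ext: "central_extension sE bE free_scale (d1_bracket d) q"
  obtain y :: 'a where "y \<noteq> 0" using assms(1) by blast
  interpret hv_extension sE bE d q y
    by (intro hv_extension.intro hv_extension_axioms.intro ext assms(2,3) \<open>y \<noteq> 0\<close>)
  show "\<exists>!h. lie_algebra_hom free_scale (hv_bracket d) sE bE h \<and> q \<circ> h = hv_proj"
  proof (rule ex1I[of _ h])
    show "lie_algebra_hom free_scale (hv_bracket d) sE bE h \<and> q \<circ> h = hv_proj"
      using lie_algebra_hom_h q_h by (simp add: fun_eq_iff)
    fix k
    assume k: "lie_algebra_hom free_scale (hv_bracket d) sE bE k \<and> q \<circ> k = hv_proj"
    then show "k = h"
      by (intro lie_algebra_hom_unique lie_algebra_hom_h) (auto simp: q_h fun_eq_iff)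
  qed
qed

end
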